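(* Let $\mathcal C$ be a binary linear block code of length $n$ used with BPSK over an AWGN channel with noise variance $\sigma^2>0$ per component, and let $A_d$ be the number of codewords of Hamming weight $d$. For all integers $1\le d\le n$ and $0\le d^*\le n$, $$\Pr\{E_d,\ W_H(\hat{\underline y})\le d^*\}\le A_d\,Q(\sqrt d/\sigma)\,B(p_b,n-d,0,d^*-1).$$
   Context: Channel: codewords are mapped by $\phi:\mathbb F_2^n\to\{-1,+1\}^n$, $\phi(\underline v)_t=1-2v_t$. The all-zero codeword $\underline c^{(0)}$ is transmitted; the received vector is $\underline y=\phi(\underline c^{(0)})+\underline z$, with $\underline z$ having i.i.d. $\mathcal N(0,\sigma^2)$ components. $E_d$ is the event that some codeword of Hamming weight $d$ has its image under $\phi$ nearer to $\underline y$ (in Euclidean distance) than $\phi(\underline c^{(0)})$. The hard-decision vector $\hat{\underline y}\in\mathbb F_2^n$ is given by $\hat y_t=0$ if $y_t>0$ and $\hat y_t=1$ if $y_t\le0$; $W_H$ is Hamming weight. Notation: $Q(x)=\int_x^{\infty}\frac1{\sqrt{2\pi}}e^{-z^2/2}\,dz$; $p_b=Q(1/\sigma)$; $B(p,N_t,N_\ell,N_u)=\sum_{m=N_\ell}^{N_u}\binom{N_t}{m}p^m(1-p)^{N_t-m}$, i.e. the probability that a Binomial$(N_t,p)$ variable lies in $[N_\ell,N_u]$; empty sums and terms with $m>N_t$ are $0$. *)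

theory Defs
  imports "HOL-Probability.Probability" "HOL-Library.Z2"
begin

definition hamming_weight :: "bit ^ 'n \<Rightarrow> nat" where
  "hamming_weight v = card {t. v $ t \<noteq> 0}"

definition num_codewords :: "(bit ^ 'n) set \<Rightarrow> nat \<Rightarrow> nat" where
  "num_codewords C d = card {c \<in> C. hamming_weight c = d}"

definition bpsk :: "bit ^ 'n \<Rightarrow> real ^ 'n" where
  "bpsk v = (\<chi> t. 1 - 2 * of_bool (v $ t = 1))"

definition hard_decision :: "real ^ 'n \<Rightarrow> bit ^ 'n" where
  "hard_decision y = (\<chi> t. if y $ t > 0 then 0 else 1)"

text \<open>The event $E_d$ as a condition on the received vector.  ``Nearer'' is strict; the
  reference word \<open>0\<close> is the transmitted all-zero codeword.\<close>

definition nearer_codeword :: "(bit ^ 'n) set \<Rightarrow> nat \<Rightarrow> real ^ 'n \<Rightarrow> bool" where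
  "nearer_codeword C d y \<longleftrightarrow>
     (\<exists>c\<in>C. hamming_weight c = d \<and> dist (bpsk c) y < dist (bpsk 0) y)"

definition Q_fun :: "real \<Rightarrow> real" where
  "Q_fun x = (LBINT z:{x..}. 1 / sqrt (2 * pi) * exp (- z\<^sup>2 / 2))"

text \<open>The summation bounds are integers, so that an upper bound of \<open>-1\<close> gives the empty sum.
  For \<open>m > Nt\<close> the exponent \<open>Nt - m\<close> truncates, but the binomial coefficient is zero.\<close>

definition binom_prob :: "real \<Rightarrow> nat \<Rightarrow> int \<Rightarrow> int \<Rightarrow> real" where
  "binom_prob p Nt Nl Nu =
     (\<Sum>m\<in>{m :: nat. Nl \<le> int m \<and> int m \<le> Nu}. real (Nt choose m) * p ^ m * (1 - p) ^ (Nt - m))"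

end

theory Submission imports Defs begin

text \<open>Union bound over the codewords \<open>c\<close> of weight \<open>d\<close>. If \<open>c\<close> is nearer to \<open>y\<close> than \<open>0\<close>, then
  \<open>y\<close> sums to a negative number over the support of \<open>c\<close>, so the support contains a hard-decision
  error and at most \<open>d\<^sup>* - 1\<close> of the errors lie outside of it. The noise on the support and the noise
  off the support are independent, whence the product form.\<close>

text \<open>The restrictions of the family to the disjoint index sets \<open>S\<close> and
  \<open>I - S\<close> are independent random vectors. The condition on the sum is a measurable
  event of the first vector, the box a measurable event of the second, and the box factorizes
  further by independence of the coordinates.\<close>

lemma (in prob_space) prob_sum_and_box:
  fixes X :: "'i \<Rightarrow> 'a \<Rightarrow> real"
  assumes indep: "indep_vars (\<lambda>_. borel) X I" and fin: "finite I" and S: "S \<subseteq> I"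
    and U: "U \<in> sets borel" and A: "\<And>i. i \<in> I - S \<Longrightarrow> A i \<in> sets borel"
  shows "prob {\<omega> \<in> space M. (\<Sum>i\<in>S. X i \<omega>) \<in> U \<and> (\<forall>i\<in>I - S. X i \<omega> \<in> A i)} =
    prob {\<omega> \<in> space M. (\<Sum>i\<in>S. X i \<omega>) \<in> U} * (\<Prod>i\<in>I - S. prob {\<omega> \<in> space M. X i \<omega> \<in> A i})"
proof -
  have finS: "finite S" using S fin by (rule finite_subset)
  let ?P = "\<lambda>J. Pi\<^sub>M J (\<lambda>_. borel :: real measure)"
  let ?R = "\<lambda>J \<omega>. restrict (\<lambda>i. X i \<omega>) J"
  let ?U = "(\<lambda>f. \<Sum>i\<in>S. f i) -` U \<inter> space (?P S)"
  let ?A = "Pi\<^sub>E (I - S) A"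
  have "(\<lambda>f. \<Sum>i\<in>S. f i :: real) \<in> borel_measurable (?P S)" by measurable
  then have U': "?U \<in> sets (?P S)" using U by (rule measurable_sets)
  have A': "?A \<in> sets (?P (I - S))" using fin A by (intro sets_PiM_I_finite) auto
  have "indep_var (?P S) (?R S) (?P (I - S)) (?R (I - S))"
    by (rule indep_var_restrict[OF indep]) (use S in auto)
  from indep_varD[OF this U' A']
  have "prob ((\<lambda>\<omega>. (?R S \<omega>, ?R (I - S) \<omega>)) -` (?U \<times> ?A) \<inter> space M) =
    prob (?R S -` ?U \<inter> space M) * prob (?R (I - S) -` ?A \<inter> space M)" .
  moreover have "(\<lambda>\<omega>. (?R S \<omega>, ?R (I - S) \<omega>)) -` (?U \<times> ?A) \<inter> space M =
      {\<omega> \<in> space M. (\<Sum>i\<in>S. X i \<omega>) \<in> U \<and> (\<forall>i\<in>I - S. X i \<omega> \<in> A i)}"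
    by (auto simp: space_PiM PiE_def Pi_def)
  moreover have "?R S -` ?U \<inter> space M = {\<omega> \<in> space M. (\<Sum>i\<in>S. X i \<omega>) \<in> U}"
    by (auto simp: space_PiM)
  moreover have "prob (?R (I - S) -` ?A \<inter> space M) =
      (\<Prod>i\<in>I - S. prob {\<omega> \<in> space M. X i \<omega> \<in> A i})"
  \<comment> \<open>The product rule is applied only to a nonempty index set. If
    \<open>S = I\<close>, as for a codeword of full weight, the box imposes no condition and the
    empty product is the probability of the whole space.\<close>
  proof (cases "I - S = {}")
    case True
    have "?R {} -` Pi\<^sub>E {} A \<inter> space M = space M" by auto
    then show ?thesis unfolding True by (simp only: prod.empty prob_space)
  next
    case False
    have "?R (I - S) -` ?A \<inter> space M = (\<Inter>i\<in>I - S. X i -` A i \<inter> space M)"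
      using False by (auto simp: PiE_def Pi_def)
    also have "prob \<dots> = (\<Prod>i\<in>I - S. prob (X i -` A i \<inter> space M))"
      by (rule indep_varsD[OF indep]) (use False fin A in auto)
    finally show ?thesis by (simp add: vimage_def Int_def conj_commute)
  qed
  ultimately show ?thesis by simp
qed

text \<open>By symmetry \<open>- X / s\<close> is standard normal, and \<open>X \<le> - a\<close>
  becomes the upper tail beyond \<open>a / s\<close>. With \<open>a = 1\<close> this is a single
  hard-decision error; with \<open>a\<close> the size of a support it is the pairwise error.\<close>

lemma (in prob_space) prob_normal_le:
  assumes X: "distributed M lborel X (normal_density 0 s)" and s: "0 < s"
  shows "prob {\<omega> \<in> space M. X \<omega> \<le> - a} = Q_fun (a / s)"
proof -
  have "distributed M lborel (\<lambda>\<omega>. 0 + (- 1 / s) * X \<omega>) (normal_density (0 + (- 1 / s) * 0) (\<bar>- 1 / s\<bar> * s))"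
    by (rule normal_density_affine[OF X]) (use s in auto)
  then have D: "distributed M lborel (\<lambda>\<omega>. - X \<omega> / s) std_normal_density"
    using s by simp
  have "prob {\<omega> \<in> space M. X \<omega> \<le> - a} = prob {\<omega> \<in> space M. - X \<omega> / s \<in> {a / s..}}"
    using s by (intro arg_cong[where f = prob]) (auto simp: field_simps)
  also have "\<dots> = (\<integral>\<omega>. indicator {\<omega> \<in> space M. - X \<omega> / s \<in> {a / s..}} \<omega> \<partial>M)"
    by (simp add: Int_absorb2)
  also have "\<dots> = (\<integral>\<omega>. indicator {a / s..} (- X \<omega> / s) \<partial>M)"
    by (intro Bochner_Integration.integral_cong) (auto simp: indicator_def)
  also have "\<dots> = (\<integral>x. std_normal_density x * indicator {a / s..} x \<partial>lborel)"
    by (rule distributed_integral[OF D, symmetric]) auto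
  also have "\<dots> = Q_fun (a / s)"
    unfolding Q_fun_def set_lebesgue_integral_def
    by (intro Bochner_Integration.integral_cong) (auto simp: std_normal_density_def)
  finally show ?thesis .
qed

text \<open>Grouping the error patterns \<open>T\<close> by their size \<open>m\<close> collects
  \<open>card R choose m\<close> equal terms. For \<open>u = -1\<close> both sides are empty
  sums.\<close>

lemma sum_power_card_eq_binom_prob:
  assumes "finite R"
  shows "(\<Sum>T | T \<subseteq> R \<and> int (card T) \<le> u. p ^ card T * (1 - p) ^ (card R - card T)) =
    binom_prob p (card R) 0 u"
proof -
  let ?K = "{m :: nat. 0 \<le> int m \<and> int m \<le> u}"
  let ?F = "{T. T \<subseteq> R \<and> int (card T) \<le> u}"
  have finK: "finite ?K" by (rule finite_subset[of _ "{..nat u}"]) auto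
  have finF: "finite ?F" using assms by auto
  have "(\<Sum>T\<in>?F. p ^ card T * (1 - p) ^ (card R - card T)) =
    (\<Sum>m\<in>?K. \<Sum>T | T \<in> ?F \<and> card T = m. p ^ card T * (1 - p) ^ (card R - card T))"
    by (rule sum.group[symmetric, OF finF finK]) auto
  also have "\<dots> = (\<Sum>m\<in>?K. real (card R choose m) * p ^ m * (1 - p) ^ (card R - m))"
  proof (rule sum.cong)
    fix m assume m: "m \<in> ?K"
    have "{T \<in> ?F. card T = m} = {T. T \<subseteq> R \<and> card T = m}" using m by auto
    then show "(\<Sum>T | T \<in> ?F \<and> card T = m. p ^ card T * (1 - p) ^ (card R - card T)) =
        real (card R choose m) * p ^ m * (1 - p) ^ (card R - m)"
      using n_subsets[OF assms, of m] by simp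
  qed simp
  finally show ?thesis unfolding binom_prob_def .
qed

text \<open>A word is determined by its support, a subset of a finite index type. This makes the
  union bound over codewords a finite one.\<close>

lemma finite_bit_vec: "finite (A :: (bit ^ 'n) set)"
proof -
  have "inj (\<lambda>c :: bit ^ 'n. {t. c $ t = 1})"
  proof (rule injI)
    fix c c' :: "bit ^ 'n" assume "{t. c $ t = 1} = {t. c' $ t = 1}"
    then have "c $ t = 1 \<longleftrightarrow> c' $ t = 1" for t by blast
    then have "c $ t = c' $ t" for t by (metis (full_types) bit_not_one_iff)
    then show "c = c'" by (simp add: vec_eq_iff)
  qed
  then have "finite (UNIV :: (bit ^ 'n) set)" by (rule finite_imageD[rotated]) simp
  then show ?thesis by (rule finite_subset[rotated]) simp
qed

text \<open>In the difference of the squared distances the coordinates off the support of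
  \<open>c\<close> cancel, and each coordinate on it contributes
  \<open>(-1 - y $ t)^2 - (1 - y $ t)^2 = 4 * y $ t\<close>.\<close>

lemma dist_bpsk_less_iff:
  "dist (bpsk c) y < dist (bpsk 0) y \<longleftrightarrow> (\<Sum>t | c $ t \<noteq> 0. y $ t) < 0"
proof -
  have "(dist (bpsk c) y)\<^sup>2 - (dist (bpsk 0) y)\<^sup>2 =
      (\<Sum>t\<in>UNIV. (bpsk c $ t - y $ t)\<^sup>2 - (bpsk 0 $ t - y $ t)\<^sup>2)"
    by (simp add: dist_vec_def L2_set_def sum_nonneg dist_real_def sum_subtractf)
  also have "\<dots> = (\<Sum>t\<in>UNIV. if c $ t \<noteq> 0 then 4 * y $ t else 0)"
    by (intro sum.cong) (auto simp: bpsk_def power2_eq_square algebra_simps)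
  also have "\<dots> = 4 * (\<Sum>t | c $ t \<noteq> 0. y $ t)"
    by (simp add: sum.If_cases sum_distrib_left)
  finally have "(dist (bpsk c) y)\<^sup>2 < (dist (bpsk 0) y)\<^sup>2 \<longleftrightarrow> (\<Sum>t | c $ t \<noteq> 0. y $ t) < 0"
    by linarith
  then show ?thesis using power2_less_imp_less[of "dist (bpsk c) y" "dist (bpsk 0) y"]
      power_strict_mono[of "dist (bpsk c) y" "dist (bpsk 0) y" 2] by auto
qed

lemma hamming_weight_hard_decision: "hamming_weight (hard_decision y) = card {t. y $ t \<le> 0}"
  unfolding hamming_weight_def hard_decision_def
  by (intro arg_cong[where f = card]) (auto simp: not_less)

text \<open>Here \<open>S\<close> is the support of one codeword and \<open>E\<close> the set of
  hard-decision errors. The event is covered by events \<open>B T\<close>, one for each possible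
  error pattern \<open>T\<close> off \<open>S\<close>, whose probabilities factorize. A measurable
  cover is all that monotonicity and the union bound require later.\<close>

lemma (in prob_space) pairwise_error_bound:
  fixes X :: "'n :: finite \<Rightarrow> 'a \<Rightarrow> real"
  assumes indep: "indep_vars (\<lambda>_. borel) X UNIV"
    and normal: "\<And>t. distributed M lborel (X t) (normal_density 0 \<sigma>)"
    and \<sigma>: "\<sigma> > 0" and S: "S \<noteq> {}"
  defines "E \<equiv> \<lambda>\<omega>. {t. 1 + X t \<omega> \<le> 0}"
  shows "\<exists>B \<in> events. {\<omega> \<in> space M. (\<Sum>t\<in>S. 1 + X t \<omega>) < 0 \<and> card (E \<omega>) \<le> k} \<subseteq> B \<and>
    prob B \<le> Q_fun (sqrt (card S) / \<sigma>) * binom_prob (Q_fun (1 / \<sigma>)) (CARD('n) - card S) 0 (int k - 1)"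
proof -
  let ?p = "Q_fun (1 / \<sigma>)"
  let ?R = "UNIV - S"
  have cardR: "card ?R = CARD('n) - card S" by (simp add: card_Diff_subset)
  \<comment> \<open>The bound is taken in \<open>int\<close>: for \<open>k = 0\<close> no pattern
    qualifies, whereas truncated subtraction would admit the empty one.\<close>
  define F where "F = {T. T \<subseteq> ?R \<and> int (card T) \<le> int k - 1}"
  \<comment> \<open>Position \<open>t\<close> is an error iff \<open>X t \<omega> \<le> -1\<close>,
    so the box prescribes that the errors off \<open>S\<close> are exactly \<open>T\<close>.\<close>
  define A :: "'n set \<Rightarrow> 'n \<Rightarrow> real set" where "A T t = (if t \<in> T then {..-1} else {-1<..})" for T t
  \<comment> \<open>Moving the \<open>card S\<close> ones to the other side turns the negative sum
    into a noise sum below \<open>- card S\<close>; the strict inequality is relaxed to fit the tail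
    formula.\<close>
  define B where "B T = {\<omega> \<in> space M. (\<Sum>t\<in>S. X t \<omega>) \<in> {..- real (card S)} \<and> (\<forall>t\<in>?R. X t \<omega> \<in> A T t)}" for T
  have meas[measurable]: "X t \<in> borel_measurable M" for t
    using distributed_measurable[OF normal[of t]] by simp
  have Am[measurable]: "A T t \<in> sets borel" for T t by (simp add: A_def)
  have Bm: "B T \<in> events" for T unfolding B_def by measurable
  have le: "prob {\<omega> \<in> space M. X t \<omega> \<in> {..-1}} = ?p" for t
    using prob_normal_le[OF normal \<sigma>, of t 1] by simp
  have gt: "prob {\<omega> \<in> space M. X t \<omega> \<in> {-1<..}} = 1 - ?p" for t
  proof -
    have "{\<omega> \<in> space M. X t \<omega> \<in> {-1<..}} = space M - {\<omega> \<in> space M. X t \<omega> \<in> {..-1}}" by auto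
    then show ?thesis using le[of t] by (simp add: prob_compl)
  qed
  have sumS: "prob {\<omega> \<in> space M. (\<Sum>t\<in>S. X t \<omega>) \<in> {..- real (card S)}} = Q_fun (sqrt (card S) / \<sigma>)"
  proof -
    have pos: "0 < real (card S)" using S by (simp add: card_gt_0_iff)
    have "distributed M lborel (\<lambda>\<omega>. \<Sum>t\<in>S. X t \<omega>) (normal_density (\<Sum>t\<in>S. 0) (sqrt (\<Sum>t\<in>S. \<sigma>\<^sup>2)))"
      by (rule sum_indep_normal) (use S \<sigma> normal indep_vars_subset[OF indep] in auto)
    then have D: "distributed M lborel (\<lambda>\<omega>. \<Sum>t\<in>S. X t \<omega>) (normal_density 0 (sqrt (card S) * \<sigma>))"
      using \<sigma> by (simp add: real_sqrt_mult)
    \<comment> \<open>The noise sum has standard deviation \<open>sqrt (card S) * \<sigma>\<close>,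
      so the threshold \<open>card S\<close> normalizes to the argument of \<open>Q_fun\<close> in
      the claim.\<close>
    have "real (card S) / (sqrt (card S) * \<sigma>) = sqrt (card S) / \<sigma>"
      using pos by (simp add: divide_divide_eq_left[symmetric] real_div_sqrt)
    then show ?thesis using prob_normal_le[OF D, of "card S"] pos \<sigma> by simp
  qed
  have probB: "prob (B T) = Q_fun (sqrt (card S) / \<sigma>) * (?p ^ card T * (1 - ?p) ^ (card ?R - card T))"
    if "T \<in> F" for T
  proof -
    have T: "T \<subseteq> ?R" using that by (simp add: F_def)
    have "(\<Prod>t\<in>?R. prob {\<omega> \<in> space M. X t \<omega> \<in> A T t}) = (\<Prod>t\<in>?R. if t \<in> T then ?p else 1 - ?p)"
      by (intro prod.cong) (use le gt in \<open>auto simp: A_def\<close>)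
    also have "\<dots> = ?p ^ card (?R \<inter> T) * (1 - ?p) ^ card (?R - T)"
      by (simp add: prod.If_cases Diff_eq Int_assoc)
    also have "?R \<inter> T = T" using T by auto
    also have "card (?R - T) = card ?R - card T" using T by (simp add: card_Diff_subset)
    finally show ?thesis
      unfolding B_def by (subst prob_sum_and_box[OF indep]) (use sumS in auto)
  qed
  \<comment> \<open>Distinct patterns give disjoint boxes, so subadditivity loses nothing
    here.\<close>
  have "prob (\<Union>T\<in>F. B T) \<le> (\<Sum>T\<in>F. prob (B T))"
    by (rule finite_measure_subadditive_finite) (use Bm in auto)
  also have "\<dots> = Q_fun (sqrt (card S) / \<sigma>) * (\<Sum>T\<in>F. ?p ^ card T * (1 - ?p) ^ (card ?R - card T))"
    by (simp add: probB sum_distrib_left)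
  also have "(\<Sum>T\<in>F. ?p ^ card T * (1 - ?p) ^ (card ?R - card T)) =
      binom_prob ?p (CARD('n) - card S) 0 (int k - 1)"
    unfolding F_def by (subst sum_power_card_eq_binom_prob) (simp_all add: cardR)
  finally have "prob (\<Union>T\<in>F. B T) \<le>
    Q_fun (sqrt (card S) / \<sigma>) * binom_prob ?p (CARD('n) - card S) 0 (int k - 1)" .
  moreover have "{\<omega> \<in> space M. (\<Sum>t\<in>S. 1 + X t \<omega>) < 0 \<and> card (E \<omega>) \<le> k} \<subseteq> (\<Union>T\<in>F. B T)"
  proof safe
    fix \<omega> assume \<omega>: "\<omega> \<in> space M" and neg: "(\<Sum>t\<in>S. 1 + X t \<omega>) < 0" and k: "card (E \<omega>) \<le> k"
    have "\<exists>t\<in>S. 1 + X t \<omega> \<le> 0"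
    proof (rule ccontr)
      assume "\<not> ?thesis"
      then have "0 \<le> (\<Sum>t\<in>S. 1 + X t \<omega>)" by (intro sum_nonneg) force
      with neg show False by simp
    qed
    \<comment> \<open>Strictness of this inclusion is the source of the upper limit
      \<open>k - 1\<close>: at least one of the \<open>k\<close> allowed errors is spent inside
      \<open>S\<close>.\<close>
    then have "E \<omega> - S \<subset> E \<omega>" by (auto simp: E_def)
    then have "card (E \<omega> - S) < card (E \<omega>)" by (intro psubset_card_mono) auto
    then have "E \<omega> - S \<in> F" using k by (auto simp: F_def)
    moreover have "\<omega> \<in> B (E \<omega> - S)"
      using \<omega> neg by (auto simp: B_def A_def E_def sum.distrib)
    ultimately show "\<omega> \<in> (\<Union>T\<in>F. B T)" by blast
  qed
  moreover have "(\<Union>T\<in>F. B T) \<in> events" using Bm by (intro sets.finite_UN) auto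
  ultimately show ?thesis by blast
qed

theorem theorem2:
  fixes C :: "(bit ^ 'n) set"
    and M :: "'a measure"
    and z y :: "'a \<Rightarrow> real ^ 'n"
    and \<sigma> :: real
    and d dstar :: nat
  assumes linear_code: "vec.subspace C"
    and sigma_pos: "\<sigma> > 0"
    and prob: "prob_space M"
    and noise_indep: "prob_space.indep_vars M (\<lambda>_. borel) (\<lambda>t \<omega>. z \<omega> $ t) UNIV"
    and noise_normal: "\<And>t. distributed M lborel (\<lambda>\<omega>. z \<omega> $ t) (normal_density 0 \<sigma>)"
    and received: "\<And>\<omega>. y \<omega> = bpsk 0 + z \<omega>"
    and d_range: "1 \<le> d" "d \<le> CARD('n)"
    and dstar_range: "dstar \<le> CARD('n)"
  shows "measure M {\<omega> \<in> space M. nearer_codeword C d (y \<omega>) \<and>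
             hamming_weight (hard_decision (y \<omega>)) \<le> dstar}
         \<le> real (num_codewords C d) * Q_fun (sqrt (real d) / \<sigma>) *
             binom_prob (Q_fun (1 / \<sigma>)) (CARD('n) - d) 0 (int dstar - 1)"
proof -
  interpret prob_space M by (rule prob)
  let ?W = "{c \<in> C. hamming_weight c = d}"
  let ?q = "Q_fun (sqrt (real d) / \<sigma>) * binom_prob (Q_fun (1 / \<sigma>)) (CARD('n) - d) 0 (int dstar - 1)"
  let ?G = "\<lambda>c. {\<omega> \<in> space M. (\<Sum>t | c $ t \<noteq> 0. 1 + z \<omega> $ t) < 0 \<and>
    card {t. 1 + z \<omega> $ t \<le> 0} \<le> dstar}"
  have y: "y \<omega> $ t = 1 + z \<omega> $ t" for \<omega> t by (simp add: received bpsk_def)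
  have "\<forall>c\<in>?W. \<exists>B. B \<in> events \<and> ?G c \<subseteq> B \<and> prob B \<le> ?q"
  proof
    fix c assume "c \<in> ?W"
    then have d: "card {t. c $ t \<noteq> 0} = d" by (simp add: hamming_weight_def)
    \<comment> \<open>Positive weight makes the support nonempty, which the pairwise bound
      requires.\<close>
    with d_range have "{t. c $ t \<noteq> 0} \<noteq> {}" by (metis card.empty not_one_le_zero)
    from pairwise_error_bound[OF noise_indep noise_normal sigma_pos this, of dstar]
    show "\<exists>B. B \<in> events \<and> ?G c \<subseteq> B \<and> prob B \<le> ?q" unfolding d Bex_def .
  qed
  \<comment> \<open>One measurable cover is chosen for each codeword of weight \<open>d\<close>. The
    bound \<open>?q\<close> is the same for all of them, so summing it produces the factor
    \<open>num_codewords C d\<close>.\<close>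
  from bchoice[OF this] obtain B
    where B: "\<And>c. c \<in> ?W \<Longrightarrow> B c \<in> events \<and> ?G c \<subseteq> B c \<and> prob (B c) \<le> ?q"
    by blast
  have "prob {\<omega> \<in> space M. nearer_codeword C d (y \<omega>) \<and>
      hamming_weight (hard_decision (y \<omega>)) \<le> dstar} \<le> prob (\<Union>c\<in>?W. B c)"
  proof (rule finite_measure_mono)
    show "(\<Union>c\<in>?W. B c) \<in> events" using B by (intro sets.finite_UN finite_bit_vec) auto
    have "{\<omega> \<in> space M. nearer_codeword C d (y \<omega>) \<and>
        hamming_weight (hard_decision (y \<omega>)) \<le> dstar} \<subseteq> (\<Union>c\<in>?W. ?G c)"
      by (auto simp: nearer_codeword_def dist_bpsk_less_iff hamming_weight_hard_decision y)
    also have "\<dots> \<subseteq> (\<Union>c\<in>?W. B c)" using B by (intro UN_mono) auto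
    finally show "{\<omega> \<in> space M. nearer_codeword C d (y \<omega>) \<and>
        hamming_weight (hard_decision (y \<omega>)) \<le> dstar} \<subseteq> (\<Union>c\<in>?W. B c)" .
  qed
  also have "\<dots> \<le> (\<Sum>c\<in>?W. prob (B c))"
    by (rule finite_measure_subadditive_finite) (use B finite_bit_vec in auto)
  also have "\<dots> \<le> (\<Sum>c\<in>?W. ?q)" using B by (intro sum_mono) auto
  also have "\<dots> = real (num_codewords C d) * Q_fun (sqrt (real d) / \<sigma>) *
      binom_prob (Q_fun (1 / \<sigma>)) (CARD('n) - d) 0 (int dstar - 1)"
    by (simp add: num_codewords_def)
  finally show ?thesis .
qed

end
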